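(* If $M$ is an indecomposable submodule of $\mathbb{C}[x,y]$, then either $M=M_d$ for some nonnegative integer $d$, or $M$ is an L-module of order $s$ for some positive integer $s$.
   Context: A submodule (or module) of $\mathbb{C}[x,y]$ is a translation invariant linear subspace of $\mathbb{C}[x,y]$; equivalently, a linear subspace closed under the partial derivatives $\partial/\partial x$ and $\partial/\partial y$. Every $F\in \mathbb{C}[x,y]$ can be written uniquely as $F(x,y)=\sum_{n=0}^\infty f_n(x)\frac{y^n}{n!}$ with $f_n\in \mathbb{C}[x]$ and $f_n=0$ for all large enough $n$; the polynomials $f_n$ are called the coordinate polynomials of $F$ and are denoted by $[F]_n$ $(n=0,1,\ldots)$. For a positive integer $s$, a set $M\subset\mathbb{C}[x,y]$ is an L-module of order $s$ if $M$ is a module and, whenever $F\in M$ and $[F]_n=0$ for every $n<s$, then $F=0$. For every nonnegative integer $d$, $M_d$ denotes the set of polynomials $F\in\mathbb{C}[x,y]$ such that $\deg [F]_n<d$ for every $n$ (in particular $M_0=\{0\}$ and $M_1=\mathbb{C}[y]$). The sum of sets of polynomials $A,B$ is $A+B=\{f+g\colon f\in A,\ g\in B\}$. A submodule $M$ is decomposable if $M$ can be represented as the sum of finitely many proper submodules of $M$ (that is, submodules contained in $M$ and different from $M$). Otherwise $M$ is indecomposable.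
   Formalization: The submodule M is additionally assumed to be different from C[x,y] itself, which is indecomposable but is neither some M_d nor an L-module of any order. *)

theory Defs
  imports
    "HOL-Computational_Algebra.Computational_Algebra"
    "HOL-Library.Set_Algebras"
    Complex_Main
begin

text \<open>
  The ring of polynomials in \<open>x\<close> and \<open>y\<close> over the complex numbers is the type
  \<^typ>\<open>complex poly poly\<close>: the outer variable is \<open>y\<close>, the coefficients are polynomials in \<open>x\<close>.
\<close>

definition eval2 :: "complex poly poly \<Rightarrow> complex \<Rightarrow> complex \<Rightarrow> complex" where
  "eval2 F x y = poly (poly F [:y:]) x"

text \<open>The polynomial \<open>F(x + a, y + b)\<close>; see \<open>eval2_translate\<close>.\<close>

definition translate :: "complex \<Rightarrow> complex \<Rightarrow> complex poly poly \<Rightarrow> complex poly poly" where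
  "translate a b F = pcompose (map_poly (\<lambda>p. pcompose p [:a, 1:]) F) [:[:b:], 1:]"

lemma eval2_translate: "eval2 (translate a b F) x y = eval2 F (x + a) (y + b)"
proof (induction F)
  case 0
  then show ?case by (simp add: eval2_def translate_def)
next
  case (pCons p F)
  have "translate a b (pCons p F) =
      [:pcompose p [:a, 1:]:] + [:[:b:], 1:] * translate a b F"
    using pCons.hyps by (simp add: translate_def map_poly_pCons pcompose_pCons)
  then show ?case
    using pCons.IH by (simp add: eval2_def poly_pcompose algebra_simps)
qed

interpretation poly2: vector_space "\<lambda>(c::complex) (F :: complex poly poly). smult [:c:] F"
  by unfold_locales (simp_all add: smult_add_right mult.commute flip: one_pCons smult_add_left)

definition submodule2 :: "complex poly poly set \<Rightarrow> bool" where
  "submodule2 M \<longleftrightarrow> poly2.subspace M \<and> (\<forall>F\<in>M. \<forall>a b. translate a b F \<in> M)"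

definition coord_poly :: "complex poly poly \<Rightarrow> nat \<Rightarrow> complex poly" where
  "coord_poly F n = smult (fact n) (coeff F n)"

lemma coord_poly_expansion:
  "F = (\<Sum>n\<le>degree F. monom (smult (1 / fact n) (coord_poly F n)) n)"
  by (simp add: coord_poly_def poly_as_sum_of_monoms)

definition L_module :: "nat \<Rightarrow> complex poly poly set \<Rightarrow> bool" where
  "L_module s M \<longleftrightarrow> submodule2 M \<and> (\<forall>F\<in>M. (\<forall>n<s. coord_poly F n = 0) \<longrightarrow> F = 0)"

text \<open>The zero polynomial counts as having degree below every \<open>d\<close>, whereas
  \<^term>\<open>degree 0\<close> is \<open>0\<close> in the library.\<close>

definition M_deg :: "nat \<Rightarrow> complex poly poly set" where
  "M_deg d = {F. \<forall>n. coord_poly F n = 0 \<or> degree (coord_poly F n) < d}"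

text \<open>Sums of sets of polynomials are elementwise. Only nonempty sums are considered, so that the
  zero module is indecomposable.\<close>

definition decomposable :: "complex poly poly set \<Rightarrow> bool" where
  "decomposable M \<longleftrightarrow> (\<exists>k N. k > 0 \<and> (\<forall>i<k. submodule2 (N i) \<and> N i \<subset> M)
      \<and> M = (\<Sum>i<(k::nat). N i))"

text \<open>The whole polynomial ring is indecomposable (the annihilator of a proper submodule in the
  domain of formal power series in the two partial derivatives is nonzero), but it is neither some
  \<open>M_deg d\<close> nor an L-module; so a classification of the indecomposable submodules in these terms
  has to be restricted to submodules different from \<^term>\<open>UNIV :: complex poly poly set\<close>.\<close>

definition indecomposable :: "complex poly poly set \<Rightarrow> bool" where
  "indecomposable M \<longleftrightarrow> submodule2 M \<and> \<not> decomposable M"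

end

theory Submission
  imports Defs
begin

text \<open>
  The proof is a double Fitting decomposition. Write \<open>T\<close> and \<open>U\<close> for the differences
  \<open>F(x + 1, y) - F(x, y)\<close> and \<open>F(x, y + 1) - F(x, y)\<close>. They serve in place of the partial
  derivatives: they too lower the degree in their variable by exactly one, so that the kernel of
  \<open>T\<^sup>d\<close> is \<open>M_deg d\<close>, but they preserve every translation-invariant subspace by definition and
  commute with translations, so that \<open>T\<^sup>n M\<close> and the kernel of \<open>T\<^sup>n\<close> in \<open>M\<close> are submodules again.

  If the intersection of \<open>T\<^sup>j M\<close> with the kernel of \<open>T\<close> stops shrinking as \<open>j\<close> grows, then so does
  \<open>T\<^sup>j M\<close>, because \<open>T\<close> is locally nilpotent. Hence \<open>M\<close> is the sum of \<open>T\<^sup>m M\<close> and the kernel of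
  \<open>T\<^sup>m\<close> for some \<open>m\<close>, and indecomposability leaves \<open>T\<^sup>m M = M\<close> or \<open>T\<^sup>m M = 0\<close>
  (\<open>fitting_dichotomy\<close>). The intersections stop shrinking as soon as one of them has bounded
  degree, since a submodule that contains a polynomial in \<open>y\<close> alone contains every polynomial in
  \<open>y\<close> of at most its degree (\<open>kernel_mem_if_order_le\<close>).

  Bounded degree is what \<open>M \<noteq> UNIV\<close> provides: were every polynomial in \<open>y\<close> contained in every
  \<open>T\<^sup>j M\<close>, one could undo the differences one at a time and find all polynomials in \<open>M\<close>
  (\<open>kernel_funpow_subset\<close>). In the case \<open>T\<^sup>m M = M\<close> this bounds the degree of all polynomials in
  \<open>y\<close> alone that \<open>M\<close> contains; since every nonzero \<open>F\<close> in \<open>M\<close> becomes such a polynomial after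
  finitely many applications of \<open>T\<close>, and \<open>T\<close> acts coordinatewise, \<open>M\<close> is an L-module. In the case
  \<open>T\<^sup>m M = 0\<close> the degrees in \<open>x\<close> are bounded, and the dichotomy applies to \<open>U\<close>. Either some \<open>U\<^sup>r\<close>
  vanishes on \<open>M\<close>, which makes \<open>M\<close> an L-module, or \<open>U M = M\<close>. In the latter case let \<open>d\<close> be least
  with \<open>T\<^sup>d M = 0\<close>. Divisibility by \<open>U\<close> makes \<open>T\<^sup>d\<^sup>-\<^sup>1 M\<close> contain polynomials in \<open>y\<close> of every degree,
  hence all of them, and undoing the differences again yields \<open>M = M_deg d\<close>.
\<close>

section \<open>Translations and differences\<close>

lemma eval2_eqI:
  assumes "\<And>x y. eval2 F x y = eval2 G x y"
  shows "F = G"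
proof -
  have "poly (F - G) [:y:] = 0" for y
    using assms by (intro poly_eq_poly_eq_iff[THEN iffD1] ext) (simp add: eval2_def)
  then have "range (\<lambda>y. [:y:]) \<subseteq> {p. poly (F - G) p = 0}"
    by auto
  moreover have "infinite (range (\<lambda>y::complex. [:y:]))"
    by (subst finite_image_iff) (simp_all add: inj_def infinite_UNIV_char_0)
  ultimately show ?thesis
    using poly_roots_finite[of "F - G"] finite_subset by auto
qed

lemma eval2_add: "eval2 (F + G) x y = eval2 F x y + eval2 G x y"
  by (simp add: eval2_def)

lemma eval2_diff: "eval2 (F - G) x y = eval2 F x y - eval2 G x y"
  by (simp add: eval2_def)

lemma eval2_smult: "eval2 (smult [:c:] F) x y = c * eval2 F x y"
  by (simp add: eval2_def)

lemma translate_add: "translate a b (F + G) = translate a b F + translate a b G"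
  by (rule eval2_eqI) (simp add: eval2_translate eval2_add eval2_diff eval2_smult)

lemma translate_smult: "translate a b (smult [:c:] F) = smult [:c:] (translate a b F)"
  by (rule eval2_eqI) (simp add: eval2_translate eval2_add eval2_diff eval2_smult)

lemma translate_diff: "translate a b (F - G) = translate a b F - translate a b G"
  by (rule eval2_eqI) (simp add: eval2_translate eval2_add eval2_diff eval2_smult)

lemma translate_commute:
  "translate a b (translate c d F) = translate c d (translate a b F)"
  by (rule eval2_eqI) (simp add: eval2_translate algebra_simps)

definition difference :: "complex \<Rightarrow> complex \<Rightarrow> complex poly poly \<Rightarrow> complex poly poly" where
  "difference a b F = translate a b F - F"

lemma funpow_difference_diff:
  "(difference a b ^^ n) (F - G) = (difference a b ^^ n) F - (difference a b ^^ n) G"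
  by (induction n) (simp_all add: difference_def translate_diff)

lemma funpow_difference_0 [simp]: "(difference a b ^^ n) 0 = 0"
  using funpow_difference_diff[of n a b 0 0] by simp

lemma funpow_difference_add:
  "(difference a b ^^ n) (F + G) = (difference a b ^^ n) F + (difference a b ^^ n) G"
  by (induction n) (simp_all add: difference_def translate_add)

lemma funpow_difference_smult:
  "(difference a b ^^ n) (smult [:c:] F) = smult [:c:] ((difference a b ^^ n) F)"
  by (induction n) (simp_all add: difference_def translate_smult smult_diff_right)

lemma funpow_difference_translate:
  "(difference a b ^^ n) (translate c d F) = translate c d ((difference a b ^^ n) F)"
  by (induction n) (simp_all add: difference_def translate_diff translate_commute[of a b])

lemma difference_commute:
  "difference a b (difference c d F) = difference c d (difference a b F)"
  by (simp add: difference_def translate_diff translate_commute[of a b])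

lemma difference_funpow_commute:
  "difference a b ((difference c d ^^ n) F) = (difference c d ^^ n) (difference a b F)"
  by (induction n) (simp_all add: difference_commute[of a b])

lemma funpow_difference_commute:
  "(difference a b ^^ m) ((difference c d ^^ n) F) = (difference c d ^^ n) ((difference a b ^^ m) F)"
  by (induction m) (simp_all add: difference_funpow_commute)

lemma funpow_difference_mono:
  assumes "(difference a b ^^ m) F = 0" "m \<le> n"
  shows "(difference a b ^^ n) F = 0"
proof -
  have "(difference a b ^^ ((n - m) + m)) F = 0"
    using assms(1) by (simp only: funpow_add comp_def funpow_difference_0)
  then show ?thesis using assms(2) by simp
qed

lemma last_nonzero:
  assumes "F \<noteq> 0" and nil: "\<exists>n. (difference p q ^^ n) F = 0"
  obtains n where "(difference p q ^^ n) F \<noteq> 0" "(difference p q ^^ Suc n) F = 0"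
proof -
  define n where "n = (LEAST n. (difference p q ^^ n) F = 0)"
  have n: "(difference p q ^^ n) F = 0"
    using nil unfolding n_def by (rule LeastI_ex)
  have "n \<noteq> 0" using n assms(1) by (cases n) auto
  then have "(difference p q ^^ (n - 1)) F \<noteq> 0"
    using not_less_Least[of "n - 1" "\<lambda>n. (difference p q ^^ n) F = 0"] by (auto simp: n_def)
  with n \<open>n \<noteq> 0\<close> show ?thesis by (intro that[of "n - 1"]) auto
qed

section \<open>Submodules\<close>

lemma submodule2_0: "submodule2 M \<Longrightarrow> 0 \<in> M"
  by (simp add: submodule2_def poly2.subspace_0)

lemma submodule2_add: "submodule2 M \<Longrightarrow> F \<in> M \<Longrightarrow> G \<in> M \<Longrightarrow> F + G \<in> M"
  by (simp add: submodule2_def poly2.subspace_add)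

lemma submodule2_diff: "submodule2 M \<Longrightarrow> F \<in> M \<Longrightarrow> G \<in> M \<Longrightarrow> F - G \<in> M"
  by (simp add: submodule2_def poly2.subspace_diff)

lemma submodule2_diff_cancel: "submodule2 M \<Longrightarrow> F - G \<in> M \<Longrightarrow> G \<in> M \<Longrightarrow> F \<in> M"
  using submodule2_add[of M "F - G" G] by simp

lemma submodule2_smult: "submodule2 M \<Longrightarrow> F \<in> M \<Longrightarrow> smult [:c:] F \<in> M"
  using poly2.subspace_scale by (auto simp: submodule2_def)

lemma submodule2_difference: "submodule2 M \<Longrightarrow> F \<in> M \<Longrightarrow> difference a b F \<in> M"
  by (simp add: submodule2_def difference_def poly2.subspace_diff)

lemma submodule2_funpow_difference:
  "submodule2 M \<Longrightarrow> F \<in> M \<Longrightarrow> (difference a b ^^ n) F \<in> M"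
  by (induction n) (simp_all add: submodule2_difference)

lemma submodule2_image:
  assumes "submodule2 M"
  shows "submodule2 ((difference a b ^^ n) ` M)"
  unfolding submodule2_def
proof (intro conjI ballI allI)
  show "poly2.subspace ((difference a b ^^ n) ` M)"
  proof (rule poly2.subspaceI)
    show "0 \<in> (difference a b ^^ n) ` M"
      using submodule2_0[OF assms] by (intro image_eqI[of _ _ 0]) simp_all
    show "F + G \<in> (difference a b ^^ n) ` M"
      if "F \<in> (difference a b ^^ n) ` M" "G \<in> (difference a b ^^ n) ` M" for F G
      using that submodule2_add[OF assms] by (auto simp flip: funpow_difference_add)
    show "smult [:k:] F \<in> (difference a b ^^ n) ` M"
      if "F \<in> (difference a b ^^ n) ` M" for k F
      using that submodule2_smult[OF assms] by (auto simp flip: funpow_difference_smult)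
  qed
next
  fix F c d assume "F \<in> (difference a b ^^ n) ` M"
  then show "translate c d F \<in> (difference a b ^^ n) ` M"
    using assms
    by (auto simp: submodule2_def simp flip: funpow_difference_translate)
qed

lemma submodule2_kernel:
  assumes "submodule2 M"
  shows "submodule2 {F \<in> M. (difference a b ^^ n) F = 0}"
proof -
  have "translate c d 0 = 0" for c d
    using translate_diff[of c d 0 0] by simp
  then show ?thesis
    using assms unfolding submodule2_def
    by (auto intro!: poly2.subspaceI intro: poly2.subspace_0 poly2.subspace_add
          poly2.subspace_scale simp: funpow_difference_add
          funpow_difference_smult funpow_difference_translate)
qed

lemma funpow_difference_image_antimono:
  assumes "submodule2 M" "m \<le> n"
  shows "(difference a b ^^ n) ` M \<subseteq> (difference a b ^^ m) ` M"
proof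
  fix F assume "F \<in> (difference a b ^^ n) ` M"
  then obtain G where "G \<in> M" "F = (difference a b ^^ (m + (n - m))) G"
    using assms(2) by auto
  then show "F \<in> (difference a b ^^ m) ` M"
    using assms(1) by (auto simp: funpow_add submodule2_funpow_difference)
qed

lemma indecomposable_sum_cases:
  assumes "indecomposable M" "submodule2 A" "submodule2 B" "M = A + B"
  shows "M = A \<or> M = B"
proof (rule ccontr)
  assume neq: "\<not> (M = A \<or> M = B)"
  have sub: "A \<subseteq> M" "B \<subseteq> M"
    using set_plus_intro[of _ A 0 B] set_plus_intro[of 0 A _ B]
      submodule2_0[OF assms(2)] submodule2_0[OF assms(3)] assms(4) by auto
  define N where "N i = (if i = (0::nat) then A else B)" for i
  have "\<forall>i<2. submodule2 (N i) \<and> N i \<subset> M"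
    using assms sub neq by (auto simp: N_def)
  moreover have "M = (\<Sum>i<(2::nat). N i)"
    by (simp add: N_def numeral_2_eq_2 assms(4))
  ultimately have "decomposable M"
    unfolding decomposable_def by (intro exI[of _ 2] exI[of _ N]) simp
  then show False using assms(1) by (simp add: indecomposable_def)
qed

text \<open>
  For \<open>F\<close> in the kernel of the \<open>n\<close>-th power, the power \<open>n - 1\<close> sends \<open>F\<close> into the kernel of the
  difference, hence to the image of some \<open>G\<close> in \<open>M\<close>, and \<open>F - G\<close> is killed by one power less.
\<close>

lemma kernel_funpow_subset:
  assumes "submodule2 M"
    and "\<And>j F. j < n \<Longrightarrow> difference a b F = 0 \<Longrightarrow> F \<in> (difference a b ^^ j) ` M"
    and "(difference a b ^^ n) F = 0"
  shows "F \<in> M"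
  using assms(2,3)
proof (induction n arbitrary: F)
  case 0
  then show ?case using assms(1) by (simp add: submodule2_0)
next
  case (Suc n)
  have "(difference a b ^^ n) F \<in> (difference a b ^^ n) ` M"
    using Suc.prems by simp
  then obtain G where G: "G \<in> M" "(difference a b ^^ n) F = (difference a b ^^ n) G"
    by auto
  then have "F - G \<in> M"
    using Suc by (simp add: funpow_difference_diff)
  then show ?case
    using submodule2_diff_cancel[OF assms(1) _ G(1)] by blast
qed

section \<open>Fitting decomposition\<close>

text \<open>
  The argument is needed with the roles of \<open>x\<close> and \<open>y\<close> in either order; the locale isolates what
  it uses. In both instances the common kernel consists of the constants.
\<close>

locale difference_pair =
  fixes a b c d :: complex
  assumes nilpotent1: "\<exists>n. (difference a b ^^ n) F = 0"
    and nilpotent2: "\<exists>n. (difference c d ^^ n) F = 0"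
    and common_kernel: "difference a b F = 0 \<Longrightarrow> difference c d F = 0 \<Longrightarrow>
      difference a b G = 0 \<Longrightarrow> difference c d G = 0 \<Longrightarrow> F \<noteq> 0 \<Longrightarrow> \<exists>k. G = smult [:k:] F"
begin

abbreviation T where "T \<equiv> difference a b"
abbreviation U where "U \<equiv> difference c d"

text \<open>
  On the kernel of \<open>T\<close>, the first vanishing power of \<open>U\<close> plays the role of the degree, with
  one-dimensional steps. Applying \<open>U\<close> to \<open>P\<close> often enough gives an element of \<open>S\<close> of the
  largest order allowed for \<open>Q\<close>; a scalar multiple of it cancels the leading part of \<open>Q\<close>.
\<close>

lemma kernel_mem_if_order_le:
  assumes S: "submodule2 S" and P: "P \<in> S" "T P = 0"
    and "n > 0 \<Longrightarrow> (U ^^ (n - 1)) P \<noteq> 0" and "T Q = 0" "(U ^^ n) Q = 0"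
  shows "Q \<in> S"
  using assms(4-)
proof (induction n arbitrary: Q)
  case 0
  then show ?case using S by (simp add: submodule2_0)
next
  case (Suc n)
  have Pn: "(U ^^ n) P \<noteq> 0" using Suc.prems by simp
  obtain e where e: "(U ^^ e) ((U ^^ n) P) \<noteq> 0" "(U ^^ Suc e) ((U ^^ n) P) = 0"
    using last_nonzero[OF Pn nilpotent2] by auto
  \<comment> \<open>\<open>R\<close> has order exactly \<open>Suc n\<close>, the order allowed for \<open>Q\<close>.\<close>
  define R where "R = (U ^^ e) P"
  have R: "R \<in> S" "T R = 0" "(U ^^ n) R \<noteq> 0" "U ((U ^^ n) R) = 0"
    using e S P by (simp_all add: R_def submodule2_funpow_difference
        difference_funpow_commute[of a b n c d] difference_funpow_commute[of a b e c d] funpow_difference_commute[of n c d e c d])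
  obtain k where k: "(U ^^ n) Q = smult [:k:] ((U ^^ n) R)"
    using common_kernel[of "(U ^^ n) R" "(U ^^ n) Q"] R Suc.prems
    by (auto simp: difference_funpow_commute[of a b n c d] difference_funpow_commute[of a b e c d])
  have "Q - smult [:k:] R \<in> S"
  proof (rule Suc.IH)
    show "(U ^^ (n - 1)) P \<noteq> 0" using Pn funpow_difference_mono[of "n - 1" c d P n] by auto
    show "T (Q - smult [:k:] R) = 0"
      using R(2) Suc.prems(2) funpow_difference_diff[of 1 a b] funpow_difference_smult[of 1 a b]
      by simp
    show "(U ^^ n) (Q - smult [:k:] R) = 0"
      using k by (simp add: funpow_difference_diff funpow_difference_smult)
  qed
  then show ?case
    using submodule2_diff_cancel[OF S _ submodule2_smult[OF S R(1)]] by blast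
qed

text \<open>
  By the preceding lemma, the part of \<open>T\<^sup>j M\<close> in the kernel of \<open>T\<close> is determined by the set of
  orders that occur in it, and these sets of numbers decrease and are finite from \<open>p\<close> on.
\<close>

lemma kernel_image_stabilises:
  assumes M: "submodule2 M"
    and bound: "\<And>F. F \<in> (T ^^ p) ` M \<Longrightarrow> T F = 0 \<Longrightarrow> (U ^^ q) F = 0"
  obtains m where "m \<ge> p"
    and "\<And>j F. j \<ge> m \<Longrightarrow> F \<in> (T ^^ m) ` M \<Longrightarrow> T F = 0 \<Longrightarrow> F \<in> (T ^^ j) ` M"
proof -
  \<comment> \<open>All numbers below some occurring order, so that \<open>E\<close> is an initial segment.\<close>
  define E where "E j = {n. \<exists>F \<in> (T ^^ j) ` M. T F = 0 \<and> (U ^^ n) F \<noteq> 0}" for j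
  have E_mono: "E j \<subseteq> E i" if "i \<le> j" for i j
    unfolding E_def
    using funpow_difference_image_antimono[OF M that] by blast
  have fin: "finite (E j)" if "j \<ge> p" for j
  proof -
    have "n < q" if n: "n \<in> E p" for n
    proof -
      obtain F where F: "F \<in> (T ^^ p) ` M" "T F = 0" "(U ^^ n) F \<noteq> 0"
        using n unfolding E_def by blast
      show ?thesis
        using funpow_difference_mono[OF bound[OF F(1,2)]] F(3) by (meson not_less)
    qed
    then have "E p \<subseteq> {..<q}" by blast
    then show ?thesis
      using E_mono[OF that] by (meson finite_lessThan finite_subset)
  qed
  obtain m where m: "m \<ge> p" "\<And>j. j \<ge> p \<Longrightarrow> card (E m) \<le> card (E j)"
    using ex_has_least_nat[of "\<lambda>j. j \<ge> p" p "\<lambda>j. card (E j)"] by blast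
  show ?thesis
  proof (rule that[OF m(1)])
    fix j F assume j: "j \<ge> m" and F: "F \<in> (T ^^ m) ` M" "T F = 0"
    have Eq: "E j = E m"
      using m j by (intro card_seteq fin E_mono m(2)) simp_all
    show "F \<in> (T ^^ j) ` M"
    proof (cases "F = 0")
      case True
      then show ?thesis using submodule2_0[OF submodule2_image[OF M]] by simp
    next
      case False
      obtain n where n: "(U ^^ n) F \<noteq> 0" "(U ^^ Suc n) F = 0"
        using last_nonzero[OF False nilpotent2] by auto
      have "n \<in> E j" using Eq n F by (auto simp: E_def)
      then obtain P where P: "P \<in> (T ^^ j) ` M" "T P = 0" "(U ^^ n) P \<noteq> 0"
        by (auto simp: E_def)
      show ?thesis
        by (rule kernel_mem_if_order_le[OF submodule2_image[OF M] P(1,2) _ F(2) n(2)]) (simp add: P(3))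
    qed
  qed
qed

text \<open>
  Induction on the number of powers of \<open>T\<close> that kill \<open>F\<close>. By hypothesis of the induction \<open>T F\<close>
  lies one step deeper than expected, which yields an element of \<open>T\<^sup>i\<^sup>+\<^sup>1 M\<close> with the same image under \<open>T\<close> as \<open>F\<close>;
  the difference of the two is in the kernel of \<open>T\<close>, where the chain is already stable.
\<close>

lemma image_stabilises:
  assumes M: "submodule2 M"
    and stab: "\<And>j F. j \<ge> m \<Longrightarrow> F \<in> (T ^^ m) ` M \<Longrightarrow> T F = 0 \<Longrightarrow> F \<in> (T ^^ j) ` M"
    and F: "F \<in> (T ^^ i) ` M" "i \<ge> m"
  shows "F \<in> (T ^^ Suc i) ` M"
proof -
  obtain n where "(T ^^ n) F = 0" using nilpotent1 by auto
  then show ?thesis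
    using F
  proof (induction n arbitrary: F i)
    case 0
    then show ?case
      using submodule2_0[OF submodule2_image[OF M]] by (simp only: funpow_0)
  next
    case (Suc n)
    have "T F \<in> (T ^^ Suc i) ` M" using Suc.prems(2) by auto
    moreover have "(T ^^ n) (T F) = 0"
      using Suc.prems(1) by (simp only: funpow_Suc_right comp_def)
    ultimately have "T F \<in> (T ^^ Suc (Suc i)) ` M"
      using Suc.IH[of "T F" "Suc i"] le_SucI[OF Suc.prems(3)] by blast
    then obtain G where G: "G \<in> M" "T F = T ((T ^^ Suc i) G)" by auto
    have Gi: "(T ^^ Suc i) G \<in> (T ^^ Suc i) ` M" using G(1) by blast
    then have "F - (T ^^ Suc i) G \<in> (T ^^ i) ` M"
      using funpow_difference_image_antimono[OF M le_SucI[OF order_refl]] Suc.prems(2)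
      by (intro submodule2_diff[OF submodule2_image[OF M]]) blast+
    then have "F - (T ^^ Suc i) G \<in> (T ^^ m) ` M"
      using funpow_difference_image_antimono[OF M Suc.prems(3)] by blast
    moreover have "T (F - (T ^^ Suc i) G) = 0"
      using G(2) funpow_difference_diff[of 1 a b] by simp
    ultimately have "F - (T ^^ Suc i) G \<in> (T ^^ Suc i) ` M"
      using Suc.prems(3) stab[of "Suc i"] le_SucI by blast
    then show ?case
      using submodule2_diff_cancel[OF submodule2_image[OF M] _ Gi] by blast
  qed
qed

text \<open>
  Once the images are stable from \<open>m\<close> on, \<open>T\<^sup>m F = T\<^sup>2\<^sup>m G\<close> is solvable and splits \<open>F\<close> as
  \<open>T\<^sup>m G + (F - T\<^sup>m G)\<close>, with the second summand killed by \<open>T\<^sup>m\<close>.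
\<close>

lemma fitting_dichotomy:
  assumes M: "indecomposable M"
    and bound: "\<And>F. F \<in> (T ^^ p) ` M \<Longrightarrow> T F = 0 \<Longrightarrow> (U ^^ q) F = 0"
  obtains m where "m \<ge> p" "(T ^^ m) ` M = M \<or> (\<forall>F\<in>M. (T ^^ m) F = 0)"
proof -
  have sub: "submodule2 M" using M by (simp add: indecomposable_def)
  obtain m where "m \<ge> p"
    and m: "\<And>j F. j \<ge> m \<Longrightarrow> F \<in> (T ^^ m) ` M \<Longrightarrow> T F = 0 \<Longrightarrow> F \<in> (T ^^ j) ` M"
    using kernel_image_stabilises[OF sub bound] by blast
  have stable: "(T ^^ m) ` M \<subseteq> (T ^^ (m + i)) ` M" for i
  proof (induction i)
    case 0
    then show ?case by simp
  next
    case (Suc i)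
    have "(T ^^ (m + i)) ` M \<subseteq> (T ^^ Suc (m + i)) ` M"
      using image_stabilises[OF sub m] le_add1 by blast
    then show ?case using Suc.IH by simp
  qed
  let ?A = "(T ^^ m) ` M" and ?B = "{F \<in> M. (T ^^ m) F = 0}"
  have "M \<subseteq> ?A + ?B"
  proof
    fix F assume F: "F \<in> M"
    then obtain G where G: "G \<in> M" "(T ^^ m) F = (T ^^ (m + m)) G"
      using stable[of m] by blast
    have "F - (T ^^ m) G \<in> ?B"
      using G F sub by (auto simp: funpow_difference_diff funpow_add
          intro: submodule2_diff submodule2_funpow_difference)
    then have "(T ^^ m) G + (F - (T ^^ m) G) \<in> ?A + ?B"
      using G(1) by (intro set_plus_intro) auto
    then show "F \<in> ?A + ?B" by simp
  qed
  moreover have "?A + ?B \<subseteq> M"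
    using sub by (auto simp: set_plus_def intro: submodule2_add submodule2_funpow_difference)
  ultimately have "M = ?A + ?B" by blast
  then have "M = ?A \<or> M = ?B"
    by (intro indecomposable_sum_cases[OF M] submodule2_image submodule2_kernel sub)
  then show ?thesis using \<open>m \<ge> p\<close> that by blast
qed

end

section \<open>The two coordinate differences\<close>

text \<open>
  The second conjunct says that the degree drops by one only. For constant \<open>p\<close> the truncated
  subtraction makes both conjuncts hold, since the difference is \<open>0\<close>.
\<close>

lemma degree_shift_diff:
  fixes p :: "'a::{idom,ring_char_0} poly"
  shows "degree (pcompose p [:1, 1:] - p) \<le> degree p - 1 \<and>
    coeff (pcompose p [:1, 1:] - p) (degree p - 1) = of_nat (degree p) * lead_coeff p"
proof (induction p)
  case 0
  then show ?case by simp
next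
  case (pCons k p)
  let ?D = "pcompose p [:1, 1:] - p"
  have eq: "pcompose (pCons k p) [:1, 1:] - pCons k p = pCons 0 ?D + ?D + p"
    by (simp add: pcompose_pCons)
  show ?case
  proof (cases "degree p")
    case 0
    then obtain e where "p = [:e:]" by (metis degree_eq_zeroE)
    then show ?thesis by (simp add: pcompose_pCons)
  next
    case (Suc n)
    then have "p \<noteq> 0" by auto
    have D: "degree ?D \<le> n" "coeff ?D n = of_nat (Suc n) * lead_coeff p"
      using pCons.IH Suc by simp_all
    have "degree (pCons 0 ?D + ?D + p) \<le> Suc n"
      using D(1) Suc by (intro degree_add_le) (auto simp: degree_pCons_le le_trans[OF degree_pCons_le])
    moreover have "coeff (pCons 0 ?D + ?D + p) (Suc n) = of_nat (Suc (Suc n)) * lead_coeff p"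
    proof -
      have "coeff (pCons 0 ?D + ?D + p) (Suc n) = coeff ?D n + coeff ?D (Suc n) + coeff p (Suc n)"
        by (simp only: coeff_add coeff_pCons_Suc)
      also have "coeff ?D (Suc n) = 0"
        using D(1) by (intro coeff_eq_0) simp
      finally show ?thesis
        unfolding D(2) using Suc by (simp add: algebra_simps)
    qed
    ultimately show ?thesis
      unfolding eq using Suc \<open>p \<noteq> 0\<close> by (simp del: coeff_diff coeff_add)
  qed
qed

lemma funpow_shift_diff_eq_0_iff:
  fixes p :: "'a::{idom,ring_char_0} poly"
  shows "((\<lambda>p. pcompose p [:1, 1:] - p) ^^ n) p = 0 \<longleftrightarrow> p = 0 \<or> degree p < n"
proof (induction n arbitrary: p)
  case 0
  then show ?case by simp
next
  case (Suc n)
  let ?D = "\<lambda>p::'a poly. pcompose p [:1, 1:] - p"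
  have "(?D ^^ Suc n) p = 0 \<longleftrightarrow> ?D p = 0 \<or> degree (?D p) < n"
    unfolding funpow_Suc_right comp_def by (rule Suc.IH)
  also have "\<dots> \<longleftrightarrow> p = 0 \<or> degree p < Suc n"
  proof (cases "degree p")
    case 0
    then obtain e where "p = [:e:]" by (metis degree_eq_zeroE)
    then show ?thesis by (simp add: pcompose_pCons)
  next
    case (Suc k)
    then have "lead_coeff p \<noteq> 0" by (metis Zero_neq_Suc degree_0 leading_coeff_0_iff)
    then have "coeff (?D p) k \<noteq> 0" "degree (?D p) \<le> k"
      using degree_shift_diff[of p] Suc by (simp_all del: of_nat_Suc coeff_diff)
    then have "?D p \<noteq> 0" "degree (?D p) = k"
      using le_degree[of "?D p" k] by auto
    then show ?thesis using Suc by auto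
  qed
  finally show ?case .
qed

lemma coeff_difference_x: "coeff (difference 1 0 F) n = pcompose (coeff F n) [:1, 1:] - coeff F n"
  by (simp add: difference_def translate_def coeff_map_poly pcompose_idR)

lemma funpow_difference_x_eq_0_iff:
  "(difference 1 0 ^^ n) F = 0 \<longleftrightarrow> (\<forall>k. coeff F k = 0 \<or> degree (coeff F k) < n)"
proof -
  have "coeff ((difference 1 0 ^^ n) F) k = ((\<lambda>p. pcompose p [:1, 1:] - p) ^^ n) (coeff F k)" for k
    by (induction n) (simp_all add: coeff_difference_x)
  then show ?thesis
    by (simp add: poly_eq_iff[of "_ F"] funpow_shift_diff_eq_0_iff)
qed

lemma M_deg_eq_kernel: "M_deg n = {F. (difference 1 0 ^^ n) F = 0}"
  by (simp add: M_deg_def coord_poly_def funpow_difference_x_eq_0_iff)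

lemma difference_y: "difference 0 1 = (\<lambda>F. pcompose F [:1, 1:] - F)"
  by (simp add: fun_eq_iff difference_def translate_def pcompose_idR map_poly_idI one_pCons)

lemma funpow_difference_y_eq_0_iff:
  "(difference 0 1 ^^ n) F = 0 \<longleftrightarrow> F = 0 \<or> degree F < n"
  by (simp add: difference_y funpow_shift_diff_eq_0_iff)

lemma nilpotent_x: "\<exists>n. (difference 1 0 ^^ n) F = 0"
proof -
  have "degree (coeff F k) < Suc (\<Sum>i\<le>degree F. degree (coeff F i))" if "coeff F k \<noteq> 0" for k
    using that by (intro le_imp_less_Suc member_le_sum) (auto simp: le_degree)
  then show ?thesis using funpow_difference_x_eq_0_iff by blast
qed

lemma nilpotent_y: "\<exists>n. (difference 0 1 ^^ n) F = 0"
  using funpow_difference_y_eq_0_iff by blast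

lemma constants_if_differences_eq_0:
  assumes "difference 1 0 F = 0" "difference 0 1 F = 0"
  obtains k where "F = [:[:k:]:]"
proof -
  have "degree F = 0" using assms(2) funpow_difference_y_eq_0_iff[of 1 F] by auto
  then obtain p where p: "F = [:p:]" by (metis degree_eq_zeroE)
  have "degree p = 0"
    using assms(1) funpow_difference_x_eq_0_iff[of 1 F] p by (auto dest: spec[of _ 0])
  then show ?thesis using that p by (metis degree_eq_zeroE)
qed

lemma common_kernel_xy:
  assumes "difference 1 0 F = 0" "difference 0 1 F = 0"
    "difference 1 0 G = 0" "difference 0 1 G = 0" "F \<noteq> 0"
  shows "\<exists>k. G = smult [:k:] F"
proof -
  obtain f where f: "F = [:[:f:]:]" using assms constants_if_differences_eq_0 by blast
  obtain g where g: "G = [:[:g:]:]" using assms constants_if_differences_eq_0 by blast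
  show ?thesis using assms(5) f g by (intro exI[of _ "g / f"]) auto
qed

interpretation xy: difference_pair 1 0 0 1
  by unfold_locales (auto intro: nilpotent_x nilpotent_y common_kernel_xy)

interpretation yx: difference_pair 0 1 1 0
  by unfold_locales (auto intro: nilpotent_x nilpotent_y common_kernel_xy)

section \<open>Indecomposable submodules\<close>

abbreviation Dx where "Dx \<equiv> difference 1 0"
abbreviation Dy where "Dy \<equiv> difference 0 1"

lemma eq_0_if_coords_eq_0:
  assumes "(Dy ^^ n) F = 0" "\<And>k. k < n \<Longrightarrow> coeff F k = 0"
  shows "F = 0"
  using assms funpow_difference_y_eq_0_iff[of n F] by (metis leading_coeff_0_iff)

text \<open>
  The kernel of \<open>Dx\<close> is the ring of polynomials in \<open>y\<close>. If it were contained in all the images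
  \<open>Dx\<^sup>p M\<close>, then \<open>M\<close> would contain the kernels of all powers of \<open>Dx\<close>, which exhaust the
  polynomial ring. A polynomial \<open>Q\<close> in \<open>y\<close> missing from some image bounds the degree there.
\<close>

lemma x_kernel_bounded:
  assumes M: "submodule2 M" and "M \<noteq> UNIV"
  obtains p q where "\<And>F. F \<in> (Dx ^^ p) ` M \<Longrightarrow> Dx F = 0 \<Longrightarrow> (Dy ^^ q) F = 0"
proof -
  obtain H where "H \<notin> M" using assms(2) by auto
  obtain n where "(Dx ^^ n) H = 0" using nilpotent_x by blast
  then obtain p Q where Q: "Dx Q = 0" "Q \<notin> (Dx ^^ p) ` M"
    using kernel_funpow_subset[OF M, of n 1 0 H] \<open>H \<notin> M\<close> by blast
  obtain q where q: "(Dy ^^ q) Q = 0" using nilpotent_y by blast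
  have "(Dy ^^ q) F = 0" if F: "F \<in> (Dx ^^ p) ` M" "Dx F = 0" for F
  proof (rule ccontr)
    assume "(Dy ^^ q) F \<noteq> 0"
    then have "(Dy ^^ (q - 1)) F \<noteq> 0" using funpow_difference_mono[of "q - 1" 0 1 F q] by auto
    then show False using xy.kernel_mem_if_order_le[OF submodule2_image[OF M] F _ Q(1) q] Q(2) by blast
  qed
  then show ?thesis using that by blast
qed

text \<open>
  Since \<open>Dx\<close> acts on each coordinate polynomial separately, vanishing coordinates stay zero while
  \<open>F\<close> is moved into the kernel of \<open>Dx\<close>, where \<open>bound\<close> leaves no room for a nonzero polynomial.
  The order is \<open>Suc q\<close> rather than \<open>q\<close> only to be positive.
\<close>

lemma L_module_if_x_kernel_bounded:
  assumes M: "submodule2 M"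
    and bound: "\<And>F. F \<in> M \<Longrightarrow> Dx F = 0 \<Longrightarrow> (Dy ^^ q) F = 0"
  shows "L_module (Suc q) M"
  unfolding L_module_def
proof (intro conjI ballI impI M)
  fix F assume F: "F \<in> M" "\<forall>n<Suc q. coord_poly F n = 0"
  show "F = 0"
  proof (rule ccontr)
    assume "F \<noteq> 0"
    then obtain e where e: "(Dx ^^ e) F \<noteq> 0" "(Dx ^^ Suc e) F = 0"
      using last_nonzero nilpotent_x by blast
    have "(Dy ^^ q) ((Dx ^^ e) F) = 0"
      using e F M by (intro bound submodule2_funpow_difference) auto
    moreover have "coeff ((Dx ^^ e) F) k = 0" if "k < q" for k
      using F(2) that by (induction e) (auto simp: coeff_difference_x coord_poly_def)
    ultimately show False using eq_0_if_coords_eq_0 e(1) by blast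
  qed
qed

text \<open>
  Unless \<open>M = 0\<close>, for the least \<open>d\<close> with \<open>Dx\<^sup>d M = 0\<close> the image \<open>Dx\<^sup>d\<^sup>-\<^sup>1 M\<close> is a nonzero module of polynomials in
  \<open>y\<close> on which \<open>Dy\<close> is surjective. It therefore contains polynomials of every degree, and so the
  whole kernel of \<open>Dx\<close>; hence \<open>M\<close> contains the kernel of \<open>Dx\<^sup>d\<close>.
\<close>

lemma eq_M_deg_if_y_divisible:
  assumes M: "submodule2 M" and div: "Dy ` M = M"
    and nil: "\<And>F. F \<in> M \<Longrightarrow> (Dx ^^ n) F = 0"
  shows "\<exists>d. M = M_deg d"
proof -
  define d where "d = (LEAST n. \<forall>F\<in>M. (Dx ^^ n) F = 0)"
  have d: "\<forall>F\<in>M. (Dx ^^ d) F = 0"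
    unfolding d_def by (rule LeastI[of _ n]) (use nil in blast)
  have "M_deg d \<subseteq> M"
  proof
    fix F assume "F \<in> M_deg d"
    then have "(Dx ^^ d) F = 0" by (simp add: M_deg_eq_kernel)
    moreover have "Q \<in> (Dx ^^ j) ` M" if j: "j < d" and Q: "Dx Q = 0" for j Q
    proof -
      have "\<not> (\<forall>F\<in>M. (Dx ^^ (d - 1)) F = 0)"
        using j not_less_Least[of "d - 1" "\<lambda>n. \<forall>F\<in>M. (Dx ^^ n) F = 0"] by (auto simp: d_def)
      then obtain F where F: "F \<in> M" "(Dx ^^ (d - 1)) F \<noteq> 0" by blast
      obtain r where r: "(Dy ^^ r) Q = 0" using nilpotent_y by blast
      have "(Dy ^^ i) ` M = M" for i
        by (induction i) (simp_all add: div flip: image_image)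
      then obtain G where G: "G \<in> M" "F = (Dy ^^ (r - 1)) G" using F(1) by blast
      let ?P = "(Dx ^^ (d - 1)) G"
      have "Dx ?P = 0" using d G(1) j by (cases d) auto
      moreover have "(Dy ^^ (r - 1)) ?P \<noteq> 0"
        using F(2) G(2) by (simp add: funpow_difference_commute[where a = 0 and b = 1 and c = 1 and d = 0])
      ultimately have "Q \<in> (Dx ^^ (d - 1)) ` M"
        using xy.kernel_mem_if_order_le[OF submodule2_image[OF M], of ?P] G(1) Q r by blast
      then show ?thesis
      proof (rule subsetD[rotated])
        show "(Dx ^^ (d - 1)) ` M \<subseteq> (Dx ^^ j) ` M"
          using j by (intro funpow_difference_image_antimono[OF M]) simp
      qed
    qed
    ultimately show "F \<in> M" using kernel_funpow_subset[OF M] by blast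
  qed
  then show ?thesis using d by (auto simp: M_deg_eq_kernel)
qed

theorem mainTheorem4:
  fixes M :: "complex poly poly set"
  assumes "indecomposable M"
    and "M \<noteq> UNIV"
  shows "(\<exists>d. M = M_deg d) \<or> (\<exists>s. s > 0 \<and> L_module s M)"
proof -
  have M: "submodule2 M" using assms(1) by (simp add: indecomposable_def)
  obtain p q where bound: "\<And>F. F \<in> (Dx ^^ p) ` M \<Longrightarrow> Dx F = 0 \<Longrightarrow> (Dy ^^ q) F = 0"
    using x_kernel_bounded[OF M assms(2)] by blast
  obtain m where m: "m \<ge> p" "(Dx ^^ m) ` M = M \<or> (\<forall>F\<in>M. (Dx ^^ m) F = 0)"
    using xy.fitting_dichotomy[OF assms(1) bound] by blast
  from m(2) show ?thesis
  proof
    assume "(Dx ^^ m) ` M = M"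
    then have "M \<subseteq> (Dx ^^ p) ` M"
      using funpow_difference_image_antimono[OF M m(1)] by metis
    then have "L_module (Suc q) M"
      using bound by (intro L_module_if_x_kernel_bounded[OF M]) blast
    then show ?thesis by blast
  next
    assume nil: "\<forall>F\<in>M. (Dx ^^ m) F = 0"
    \<comment> \<open>Starting the chain at exponent 1 rather than 0 excludes the empty conclusion \<open>Dy\<^sup>0 M = M\<close>.\<close>
    have "(Dx ^^ m) F = 0" if "F \<in> (Dy ^^ 1) ` M" for F
      using that nil submodule2_difference[OF M] by auto
    then obtain r where r: "r \<ge> 1" "(Dy ^^ r) ` M = M \<or> (\<forall>F\<in>M. (Dy ^^ r) F = 0)"
      using yx.fitting_dichotomy[OF assms(1), of 1 m] by blast
    from r(2) show ?thesis
    proof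
      assume "(Dy ^^ r) ` M = M"
      then have "Dy ` M = M"
        using funpow_difference_image_antimono[OF M r(1), where a = 0 and b = 1]
          submodule2_difference[OF M] by auto
      then show ?thesis using eq_M_deg_if_y_divisible[OF M] nil by blast
    next
      assume "\<forall>F\<in>M. (Dy ^^ r) F = 0"
      then have "L_module (Suc r) M"
        by (intro L_module_if_x_kernel_bounded[OF M]) blast
      then show ?thesis by blast
    qed
  qed
qed

end
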